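(* Let $A\in\mathbb{R}^{m\times n}$, $b\in\mathbb{R}^m$ with $Ax=b$ consistent, and let $\{x^k\}_{k\ge0}$ be generated by the RIM-AS algorithm described in the context with $\ell=\infty$ and $\Omega=\{I_m\}$ (i.e. $S_k=I_m$ for all $k$). Let $r^k=Ax^k-b$. Then for each $k\ge0$, $$\operatorname{span}\{A^\top r^0,\ldots,A^\top r^k\}=\mathcal{K}_{k+1}(A^\top A,A^\top r^0).$$
   Context: RIM-AS algorithm with $\ell=\infty$ and $S_k=I_m$: start from $x^0\in\operatorname{Range}(A^\top)$; for $k=0,1,\dots$ (as long as $Ax^k\neq b$): set $M_k=(x^0-x^k,\dots,x^{k-1}-x^k,-A^\top(Ax^k-b))\in\mathbb{R}^{n\times(k+1)}$, $\gamma_k=\|Ax^k-b\|_2^2$, let $s_k$ solve $M_k^\top M_ks_k=\gamma_ke$ with $e$ the last standard unit vector of $\mathbb{R}^{k+1}$, and set $x^{k+1}=x^k+M_ks_k$. For $B\in\mathbb{R}^{n\times n}$, $r\in\mathbb{R}^n$, the Krylov subspace is $\mathcal{K}_p(B,r)=\operatorname{span}\{r,Br,\dots,B^{p-1}r\}$. *)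

theory Defs
  imports "HOL-Analysis.Analysis"
begin

text \<open>Krylov subspace K_p(B,r) = span {r, Br, ..., B^(p-1) r}.\<close>
definition krylov :: "real^'n^'n \<Rightarrow> real^'n \<Rightarrow> nat \<Rightarrow> (real^'n) set" where
  "krylov B r p = span {((\<lambda>v. B *v v) ^^ i) r | i. i < p}"

text \<open>Columns of M_k = (x^0 - x^k, ..., x^(k-1) - x^k, -A^T(A x^k - b)), indexed j = 0..k.\<close>
definition rimas_col :: "real^'n^'m \<Rightarrow> real^'m \<Rightarrow> (nat \<Rightarrow> real^'n) \<Rightarrow> nat \<Rightarrow> nat \<Rightarrow> real^'n" where
  "rimas_col A b x k j = (if j < k then x j - x k else - (transpose A *v (A *v x k - b)))"

text \<open>M_k s for s in R^(k+1) (coordinates s 0, ..., s k).\<close>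
definition rimas_Ms :: "real^'n^'m \<Rightarrow> real^'m \<Rightarrow> (nat \<Rightarrow> real^'n) \<Rightarrow> nat \<Rightarrow> (nat \<Rightarrow> real) \<Rightarrow> real^'n" where
  "rimas_Ms A b x k s = (\<Sum>j\<le>k. s j *\<^sub>R rimas_col A b x k j)"

text \<open>One RIM-AS step (l = infinity, S_k = I_m): s solves M_k^T M_k s = gamma_k e with
  gamma_k = ||A x^k - b||^2, e the last unit vector of R^(k+1), and x^(k+1) = x^k + M_k s.\<close>
definition rimas_step :: "real^'n^'m \<Rightarrow> real^'m \<Rightarrow> (nat \<Rightarrow> real^'n) \<Rightarrow> nat \<Rightarrow> bool" where
  "rimas_step A b x k \<longleftrightarrow>
     (\<exists>s :: nat \<Rightarrow> real.
        (\<forall>i\<le>k. rimas_col A b x k i \<bullet> rimas_Ms A b x k s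
                 = (if i = k then (norm (A *v x k - b))\<^sup>2 else 0))
      \<and> x (Suc k) = x k + rimas_Ms A b x k s)"

end

theory Submission
  imports Defs
begin

(* Write g_j = A^T (A x^j - b).  The orthogonality conditions defining s_k give
   |M_k s_k|^2 = s_k(k) * gamma_k > 0, so the last coefficient of s_k is nonzero and
   x^(k+1) - x^k = sum_(l<k) s_k(l) (x^l - x^k) - s_k(k) g_k.  By induction this yields
   span {x^l - x^0 | l <= k} = span {g_0, ..., g_(k-1)}.  As g_l - g_0 = A^T A (x^l - x^0),
   span {g_0, ..., g_k} = span ({g_0} u A^T A span {g_0, ..., g_(k-1)}), which is exactly the
   recursion K_(k+1) = span ({r} u B K_k) of Krylov subspaces. *)

definition normal_residual :: "real^'n^'m \<Rightarrow> real^'m \<Rightarrow> real^'n \<Rightarrow> real^'n" where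
  "normal_residual A b v = transpose A *v (A *v v - b)"

lemma normal_residual_diff:
  "normal_residual A b v - normal_residual A b w = (transpose A ** A) *v (v - w)"
  by (simp add: normal_residual_def matrix_vector_mul_assoc[symmetric]
      matrix_vector_mult_diff_distrib)

lemma span_insert_span: "span (insert a (span S)) = span (insert a S)"
  by (simp only: span_insert span_span)

lemma span_insert_cong: "span S = span T \<Longrightarrow> span (insert a S) = span (insert a T)"
  by (simp add: span_insert)

lemma span_insert_scaleR:
  assumes "c \<noteq> 0"
  shows "span (insert (c *\<^sub>R a) S) = span (insert a S)"
proof -
  have "(\<exists>k. v - k *\<^sub>R (c *\<^sub>R a) \<in> span S) \<longleftrightarrow> (\<exists>k. v - k *\<^sub>R a \<in> span S)" for v
    using assms by (metis scaleR_scaleR nonzero_eq_divide_eq)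
  then show ?thesis
    by (simp add: span_insert)
qed

lemma span_insert_exchange:
  assumes "a - c *\<^sub>R b \<in> span S" and "c \<noteq> 0"
  shows "span (insert a S) = span (insert b S)"
  using eq_span_insert_eq[OF assms(1)] span_insert_scaleR[OF assms(2)] by simp

lemma span_insert_translate:
  "span (insert a ((\<lambda>v. v - a) ` S)) = span (insert a S)"
proof (rule antisym; rule span_minimal)
  show "insert a ((\<lambda>v. v - a) ` S) \<subseteq> span (insert a S)"
    by (auto intro: span_diff span_base)
  have "v \<in> span (insert a ((\<lambda>v. v - a) ` S))" if "v \<in> S" for v
  proof -
    have "v - a \<in> span (insert a ((\<lambda>v. v - a) ` S))" "a \<in> span (insert a ((\<lambda>v. v - a) ` S))"
      using that by (auto intro: span_base)
    then show ?thesis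
      using span_add by fastforce
  qed
  then show "insert a S \<subseteq> span (insert a ((\<lambda>v. v - a) ` S))"
    by (auto intro: span_base)
qed auto

lemma krylov_Suc: "krylov B r (Suc p) = span (insert r ((*v) B ` krylov B r p))"
proof -
  let ?P = "\<lambda>i. ((\<lambda>v. B *v v) ^^ i) r"
  have gens: "{?P i | i. i < q} = ?P ` {..<q}" for q
    by auto
  have "?P ` {..<Suc p} = insert r ((*v) B ` ?P ` {..<p})"
    by (simp add: lessThan_Suc_eq_insert_0 image_image)
  then show ?thesis
    unfolding krylov_def gens
    by (simp add: span_linear_image[OF matrix_vector_mul_linear, symmetric] span_insert_span)
qed

lemma normal_system_last_coeff_nonzero:
  fixes c :: "nat \<Rightarrow> 'a::real_inner"
  assumes orth: "\<And>i. i \<le> k \<Longrightarrow> c i \<bullet> (\<Sum>l\<le>k. s l *\<^sub>R c l) = (if i = k then \<gamma> else 0)"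
    and "\<gamma> \<noteq> 0"
  shows "s k \<noteq> 0"
proof
  assume "s k = 0"
  let ?v = "\<Sum>l\<le>k. s l *\<^sub>R c l"
  have "?v \<bullet> ?v = (\<Sum>l\<le>k. s l * (c l \<bullet> ?v))"
    by (simp add: inner_sum_left)
  also have "\<dots> = (\<Sum>l\<le>k. s l * (if l = k then \<gamma> else 0))"
    by (rule sum.cong) (simp_all add: orth)
  also have "\<dots> = s k * \<gamma>"
    by (simp add: if_distrib cong: if_cong)
  finally have "?v = 0"
    using \<open>s k = 0\<close> by simp
  then show False
    using orth[of k] \<open>\<gamma> \<noteq> 0\<close> by simp
qed

lemma rimas_step_increment:
  assumes "rimas_step A b x k" and "A *v x k \<noteq> b"
  obtains c where "c \<noteq> 0"
    and "x (Suc k) - x k - c *\<^sub>R normal_residual A b (x k) \<in> span ((\<lambda>l. x l - x k) ` {..<k})"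
proof -
  obtain s where orth: "\<And>i. i \<le> k \<Longrightarrow> rimas_col A b x k i \<bullet> rimas_Ms A b x k s
                 = (if i = k then (norm (A *v x k - b))\<^sup>2 else 0)"
    and next_iterate: "x (Suc k) = x k + rimas_Ms A b x k s"
    using assms(1) unfolding rimas_step_def by blast
  have "s k \<noteq> 0"
    using orth assms(2) unfolding rimas_Ms_def
    by (intro normal_system_last_coeff_nonzero[where c = "rimas_col A b x k"]) auto
  have "rimas_Ms A b x k s
      = (\<Sum>l<k. s l *\<^sub>R (x l - x k)) - s k *\<^sub>R normal_residual A b (x k)"
    by (simp add: rimas_Ms_def rimas_col_def normal_residual_def lessThan_Suc_atMost[symmetric])
  then have "x (Suc k) - x k - (- s k) *\<^sub>R normal_residual A b (x k) = (\<Sum>l<k. s l *\<^sub>R (x l - x k))"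
    using next_iterate by simp
  also have "\<dots> \<in> span ((\<lambda>l. x l - x k) ` {..<k})"
    by (intro span_sum span_scale span_base) auto
  finally show thesis
    using that[of "- s k"] \<open>s k \<noteq> 0\<close> by simp
qed

lemma rimas_increments_span_eq:
  assumes iter: "\<And>k. A *v x k \<noteq> b \<Longrightarrow> rimas_step A b x k"
    and generated: "\<forall>j<k. A *v x j \<noteq> b"
  shows "span ((\<lambda>l. x l - x 0) ` {..k}) = span ((\<lambda>j. normal_residual A b (x j)) ` {..<k})"
  using generated
proof (induction k)
  case 0
  then show ?case
    by (simp add: span_insert_0)
next
  case (Suc k)
  let ?D = "(\<lambda>l. x l - x 0) ` {..k}"
  let ?g = "normal_residual A b (x k)"
  have IH: "span ?D = span ((\<lambda>j. normal_residual A b (x j)) ` {..<k})"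
    using Suc by simp
  have "A *v x k \<noteq> b"
    using Suc.prems by simp
  then obtain c where "c \<noteq> 0"
    and step: "x (Suc k) - x k - c *\<^sub>R ?g \<in> span ((\<lambda>l. x l - x k) ` {..<k})"
    using iter rimas_step_increment by metis
  have base: "x l - x 0 \<in> span ?D" if "l \<le> k" for l
    using that by (intro span_base) auto
  have "(\<lambda>l. x l - x k) ` {..<k} \<subseteq> span ?D"
  proof
    fix v assume "v \<in> (\<lambda>l. x l - x k) ` {..<k}"
    then obtain l where "l < k" "v = x l - x k"
      by auto
    then show "v \<in> span ?D"
      using span_diff[OF base[of l] base[of k]] by simp
  qed
  then have "x (Suc k) - x k - c *\<^sub>R ?g \<in> span ?D"
    using step span_mono span_span by blast
  then have "(x (Suc k) - x k - c *\<^sub>R ?g) + (x k - x 0) \<in> span ?D"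
    using base[of k] span_add by blast
  then have "span (insert (x (Suc k) - x 0) ?D) = span (insert ?g ?D)"
    using \<open>c \<noteq> 0\<close> by (intro span_insert_exchange[where c = c]) (simp add: algebra_simps)
  then show ?case
    using span_insert_cong[OF IH, of ?g] by (simp add: atMost_Suc lessThan_Suc)
qed

lemma span_normal_residuals_eq:
  fixes v :: "nat \<Rightarrow> real^'n"
  shows "span ((\<lambda>j. normal_residual A b (v j)) ` {..k})
     = span (insert (normal_residual A b (v 0))
         ((*v) (transpose A ** A) ` span ((\<lambda>l. v l - v 0) ` {..k})))"
proof -
  let ?g = "\<lambda>j. normal_residual A b (v j)"
  have "(*v) (transpose A ** A) ` span ((\<lambda>l. v l - v 0) ` {..k})
      = span ((\<lambda>w. w - ?g 0) ` ?g ` {..k})"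
    by (simp add: span_linear_image[OF matrix_vector_mul_linear, symmetric] image_image
        normal_residual_diff)
  moreover have "?g 0 \<in> ?g ` {..k}"
    by (rule imageI) simp
  ultimately show ?thesis
    by (simp add: span_insert_span span_insert_translate insert_absorb)
qed

theorem lemma4p2:
  fixes A :: "real^'n^'m" and b :: "real^'m" and x :: "nat \<Rightarrow> real^'n"
  assumes consistent: "\<exists>z. A *v z = b"
    and x0: "x 0 \<in> range (\<lambda>y. transpose A *v y)"
    and iter: "\<And>k. A *v x k \<noteq> b \<Longrightarrow> rimas_step A b x k"
    and generated: "\<forall>j<k. A *v x j \<noteq> b"
  shows "span ((\<lambda>j. transpose A *v (A *v x j - b)) ` {0..k})
           = krylov (transpose A ** A) (transpose A *v (A *v x 0 - b)) (Suc k)"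
proof -
  let ?g = "\<lambda>j. normal_residual A b (x j)"
  let ?K = "krylov (transpose A ** A) (?g 0)"
  have "span (?g ` {..<j}) = ?K j" if "j \<le> Suc k" for j
    using that
  proof (induction j)
    case 0
    then show ?case
      by (simp add: krylov_def)
  next
    case (Suc j)
    have "span (?g ` {..<Suc j})
        = span (insert (?g 0) ((*v) (transpose A ** A) ` span ((\<lambda>l. x l - x 0) ` {..j})))"
      by (simp add: lessThan_Suc_atMost span_normal_residuals_eq)
    also have "\<dots> = span (insert (?g 0) ((*v) (transpose A ** A) ` span (?g ` {..<j})))"
      using Suc.prems generated rimas_increments_span_eq[OF iter, of j] by simp
    also have "\<dots> = ?K (Suc j)"
      using Suc by (simp add: krylov_Suc)
    finally show ?case .
  qed
  from this[of "Suc k"] show ?thesis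
    by (simp add: normal_residual_def atLeast0AtMost lessThan_Suc_atMost)
qed

end
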